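(* Let $p$ be an odd prime, let $k$ be an integer with $0\le k\le p-1$, and let $n>1$ be an even integer. Consider $$f_{n,k}(x)=k\sum_{j\geq 0}\binom{n-1}{2j+1}(x^j-x^{j+1})+2\sum_{j\geq 0}\binom{n}{2j}x^j\in\mathbb{F}_p[x]$$ (coefficients reduced modulo $p$). Then $f_{n,k}(x)$ is self-reciprocal if and only if one of the following holds: (i) $k=0$; (ii) $k=2$ and $n\neq 2lp$ for every positive integer $l$.
   Context: $\mathbb{F}_p$ is the field with $p$ elements. Binomial coefficients $\binom{a}{b}$ are $0$ when $b>a$. A nonzero polynomial $f(x)$ of (actual) degree $d\ge 0$ is self-reciprocal if $x^d f(1/x)=f(x)$, i.e. writing $f(x)=\sum_{i=0}^d a_ix^i$ with $a_d\neq 0$, $a_i=a_{d-i}$ for all $0\le i\le d$; nonzero constants count as self-reciprocal. *)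

theory Defs
  imports "Berlekamp_Zassenhaus.Finite_Field"
begin

text \<open>
  The field with \<open>p\<close> elements is \<open>'p mod_ring\<close> with \<open>'p :: prime_card\<close> and \<open>CARD('p) = p\<close>.
\<close>

text \<open>
  \<open>reflect_poly f\<close> is \<open>x ^ d * f (1 / x)\<close> with \<open>d\<close> the actual degree of \<open>f\<close>.  It fixes the
  zero polynomial, which therefore has to be excluded by hand.
\<close>

definition self_reciprocal :: "'a::zero poly \<Rightarrow> bool" where
  "self_reciprocal f \<longleftrightarrow> f \<noteq> 0 \<and> reflect_poly f = f"

lemma self_reciprocal_iff_coeff:
  "self_reciprocal f \<longleftrightarrow>
    f \<noteq> 0 \<and> (\<forall>i\<le>degree f. coeff f i = coeff f (degree f - i))"
proof -
  have "reflect_poly f = f \<longleftrightarrow> (\<forall>i. coeff (reflect_poly f) i = coeff f i)"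
    by (rule poly_eq_iff)
  also have "\<dots> \<longleftrightarrow> (\<forall>i\<le>degree f. coeff f i = coeff f (degree f - i))"
    unfolding coeff_reflect_poly by (metis coeff_eq_0 not_le)
  finally show ?thesis
    unfolding self_reciprocal_def by (rule arg_cong)
qed

text \<open>
  The sums over all \<open>j \<ge> 0\<close> are cut off at \<open>j = n\<close>: for \<open>j > n\<close> both
  binomial coefficients vanish.
\<close>

definition f_poly :: "nat \<Rightarrow> int \<Rightarrow> 'a::comm_ring_1 poly" where
  "f_poly n k =
     smult (of_int k)
       (\<Sum>j\<le>n. smult (of_nat ((n - 1) choose (2 * j + 1))) (monom 1 j - monom 1 (j + 1)))
     + smult 2 (\<Sum>j\<le>n. monom (of_nat (n choose (2 * j))) j)"

end

theory Submission
  imports Defs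
begin

text \<open>
  By Pascal's rule the coefficient of \<open>x ^ j\<close> is \<open>k * C(n,2j+1) + (2 - k) * C(n,2j)\<close>.  The second
  summand is symmetric under \<open>j \<leftrightarrow> n/2 - j\<close>, the first one under \<open>j \<leftrightarrow> n/2 - 1 - j\<close>.  For
  \<open>k = 0\<close> only the second one is present.  For \<open>k = 2\<close> only the first one is, and the constant
  coefficient is \<open>2n\<close>, so that everything depends on whether \<open>p\<close> divides \<open>n\<close>.  For
  all other \<open>k\<close> the degree is \<open>n/2\<close> and symmetry amounts to \<open>C(n,2j+1) = C(n,2j-1)\<close> for
  all \<open>j\<close>, hence to the vanishing of all \<open>C(n,2j+1)\<close> in the field, although their
  sum is \<open>2 ^ (n-1)\<close>.
\<close>

lemma coeff_f_poly:
  assumes "n > 0"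
  shows "coeff (f_poly n k :: 'a::comm_ring_1 poly) j =
    of_int k * of_nat (n choose (2 * j + 1)) + (2 - of_int k) * of_nat (n choose (2 * j))"
proof -
  let ?odd = "\<Sum>j\<le>n. smult (of_nat ((n - 1) choose (2 * j + 1))) (monom 1 j - monom 1 (j + 1)) :: 'a poly"
  let ?even = "\<Sum>j\<le>n. monom (of_nat (n choose (2 * j))) j :: 'a poly"
  have large: "n choose (2 * j) = 0" "(n - 1) choose (2 * j + 1) = 0" if "\<not> j \<le> n"
    using that by (auto intro: binomial_eq_0)
  have even_part: "coeff ?even j = of_nat (n choose (2 * j))"
    by (cases "j \<le> n") (simp_all add: coeff_sum large del: binomial_eq_0_iff)
  \<comment> \<open>The monomials leave C(n-1,2j+1) - C(n-1,2j-1), without the second term if j = 0.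
    Adding and subtracting C(n-1,2j) and using Pascal's rule twice gives the right-hand
    side.\<close>
  have odd_part: "coeff ?odd j = of_nat (n choose (2 * j + 1)) - of_nat (n choose (2 * j))"
  proof (cases j)
    case 0
    have "coeff ?odd j = (\<Sum>l\<le>n. if l = 0 then of_nat ((n - 1) choose (2 * l + 1)) else 0)"
      unfolding coeff_sum by (rule sum.cong) (auto simp: 0)
    then show ?thesis
      using assms by (simp add: 0 of_nat_diff)
  next
    case (Suc i)
    have "coeff ?odd j =
        (\<Sum>l\<le>n. if l = j then of_nat ((n - 1) choose (2 * l + 1)) else 0) -
        (\<Sum>l\<le>n. if l = i then of_nat ((n - 1) choose (2 * l + 1)) else 0)"
      unfolding coeff_sum sum_subtractf[symmetric] by (rule sum.cong) (auto simp: Suc)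
    also have "\<dots> = of_nat ((n - 1) choose (2 * j + 1)) - of_nat ((n - 1) choose (2 * i + 1))"
      using large(2) Suc by (auto simp: binomial_eq_0)
    also have "\<dots> = of_nat (n choose (2 * j + 1)) - of_nat (n choose (2 * j))"
      using assms by (cases n) (simp_all add: Suc)
    finally show ?thesis .
  qed
  have "coeff (f_poly n k :: 'a poly) j = of_int k * coeff ?odd j + 2 * coeff ?even j"
    by (simp add: f_poly_def)
  then show ?thesis
    unfolding odd_part even_part by (simp add: algebra_simps)
qed

text \<open>The first two hypotheses force \<open>degree f = d\<close>, so symmetry can be checked
  about an explicit \<open>d\<close>.\<close>

lemma self_reciprocalI:
  assumes "coeff f d \<noteq> 0" and "\<And>i. i > d \<Longrightarrow> coeff f i = 0"
    and "\<And>i. i \<le> d \<Longrightarrow> coeff f i = coeff f (d - i)"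
  shows "self_reciprocal f"
proof -
  have "degree f = d"
    using assms(1,2) by (metis le_antisym le_degree leading_coeff_0_iff coeff_0 not_le)
  then show ?thesis
    unfolding self_reciprocal_iff_coeff using assms(1,3) by (metis coeff_0)
qed

text \<open>The constant coefficient of \<open>reflect_poly f\<close> is the leading coefficient of
  \<open>f\<close>.\<close>

lemma self_reciprocal_coeff_0:
  assumes "self_reciprocal f"
  shows "coeff f 0 \<noteq> 0"
  using assms by (metis coeff_0_reflect_poly_0_iff self_reciprocal_def)

lemma of_int_mod_ring_eq_0_iff:
  "(of_int a :: 'a::nontriv mod_ring) = 0 \<longleftrightarrow> int CARD('a) dvd a"
  by transfer (auto simp: dvd_eq_mod_eq_0)

text \<open>Twice the sum of these binomials is 2^n, which is nonzero in an integral domain with 2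
  nonzero.\<close>

lemma exists_odd_binomial_nonzero:
  assumes "(2 :: 'a::idom) \<noteq> 0" and "n > 0"
  shows "\<exists>j. (of_nat (n choose (2 * j + 1)) :: 'a) \<noteq> 0"
proof (rule ccontr)
  assume "\<not> ?thesis"
  then have "(\<Sum>i\<le>n. if odd i then of_nat (n choose i) else 0 :: 'a) = 0"
    by (intro sum.neutral) (auto elim!: oddE)
  with choose_odd_sum[OF \<open>n > 0\<close>, where 'a = 'a] assms(1) show False
    by simp
qed

text \<open>As C(n,2(m-j)+1) = C(n,2j-1), the hypothesis links consecutive odd indices. The chain
  starts from 0, since for j = 0 the right-hand side is C(n,n+1).\<close>

lemma odd_binomials_vanish:
  assumes "n = 2 * m" "n > 0"
    and "\<And>j. j \<le> m \<Longrightarrow>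
      (of_nat (n choose (2 * j + 1)) :: 'a::ring_1) = of_nat (n choose (2 * (m - j) + 1))"
  shows "(of_nat (n choose (2 * j + 1)) :: 'a) = 0"
proof (induction j)
  case 0
  then show ?case
    using assms(3)[of 0] assms(1) by (simp add: binomial_eq_0)
next
  case (Suc j)
  show ?case
  proof (cases "Suc j \<le> m")
    case True
    then have "n choose (2 * (m - Suc j) + 1) = n choose (2 * j + 1)"
      using assms(1) by (subst binomial_symmetric) (auto intro!: arg_cong[of _ _ "(choose) (2 * m)"])
    with Suc.IH assms(3)[OF True] show ?thesis
      by simp
  next
    case False
    then show ?thesis
      using assms(1) by (simp add: binomial_eq_0)
  qed
qed

text \<open>Only the images of \<open>k\<close> and \<open>n\<close> in the domain matter here;
  divisibility by \<open>p\<close> enters in the final theorem.\<close>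

lemma self_reciprocal_f_poly_iff:
  fixes k :: int
  assumes two: "(2 :: 'a::idom) \<noteq> 0" and "n > 0" "even n"
  shows "self_reciprocal (f_poly n k :: 'a poly) \<longleftrightarrow>
    (of_int k :: 'a) = 0 \<or> (of_int k :: 'a) = 2 \<and> (of_nat n :: 'a) \<noteq> 0"
proof -
  obtain m where m: "n = 2 * m"
    using \<open>even n\<close> by (elim evenE)
  let ?f = "f_poly n k :: 'a poly" and ?k = "of_int k :: 'a"
  note c = coeff_f_poly[OF \<open>n > 0\<close>, where 'a = 'a]
  have sym: "n choose (2 * (m - j)) = n choose (2 * j)" if "j \<le> m" for j
    using that binomial_symmetric[of "2 * j" n] by (simp add: m diff_mult_distrib2)
  have zero: "coeff ?f i = 0" if "i > m" for i
    using that unfolding c by (simp add: m binomial_eq_0)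
  have top: "coeff ?f m = 2 - ?k"
    unfolding c by (simp add: m binomial_eq_0)
  consider "?k = 0" | "?k = 2" | "?k \<noteq> 0" "?k \<noteq> 2"
    by metis
  then show ?thesis
  proof cases
    case 1
    have "self_reciprocal ?f"
      by (rule self_reciprocalI[of _ m]) (use top two zero sym 1 in \<open>auto simp: c\<close>)
    with 1 show ?thesis by simp
  next
    case 2
    show ?thesis
    proof (cases "(of_nat n :: 'a) = 0")
      case True
      then have "coeff ?f 0 = 0"
        by (simp add: c 2)
      then have "\<not> self_reciprocal ?f"
        using self_reciprocal_coeff_0 by blast
      with True 2 two show ?thesis
        by simp
    next
      case False
      \<comment> \<open>For k = 2 the coefficient at \<open>m\<close> vanishes, so the centre of
        symmetry moves: j to m-1-j takes the index 2j+1 to n-(2j+1).\<close>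
      have sym': "n choose (2 * (m - 1 - j) + 1) = n choose (2 * j + 1)" if "j \<le> m - 1" for j
      proof -
        have "2 * (m - 1 - j) + 1 = n - (2 * j + 1)" "2 * j + 1 \<le> n"
          using that m \<open>n > 0\<close> by auto
        then show ?thesis
          using binomial_symmetric[of "2 * j + 1" n] by simp
      qed
      have "self_reciprocal ?f"
      proof (rule self_reciprocalI[of _ "m - 1"])
        \<comment> \<open>The new top coefficient is 2 C(n,n-1) = 2n.\<close>
        show "coeff ?f (m - 1) \<noteq> 0"
          using sym'[of 0] False two by (simp add: c 2)
        show "coeff ?f i = 0" if "i > m - 1" for i
          using that unfolding c 2 by (simp add: m binomial_eq_0)
        show "coeff ?f i = coeff ?f (m - 1 - i)" if "i \<le> m - 1" for i
          unfolding c 2 sym'[OF that] by simp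
      qed
      with False 2 show ?thesis by simp
    qed
  next
    case 3
    have "\<not> self_reciprocal ?f"
    proof
      assume sr: "self_reciprocal ?f"
      have "degree ?f = m"
        using top 3 zero by (metis le_antisym le_degree leading_coeff_0_iff coeff_0 not_le right_minus_eq)
      have "(of_nat (n choose (2 * j + 1)) :: 'a) = of_nat (n choose (2 * (m - j) + 1))"
        if "j \<le> m" for j
      proof -
        have "coeff ?f j = coeff ?f (m - j)"
          using sr that \<open>degree ?f = m\<close> unfolding self_reciprocal_iff_coeff by blast
        \<comment> \<open>The even-index terms agree on both sides and cancel; then the nonzero
          factor \<open>?k\<close> is divided out.\<close>
        then show ?thesis
          unfolding c sym[OF that] using 3 by simp
      qed
      then have "(of_nat (n choose (2 * j + 1)) :: 'a) = 0" for j
        using odd_binomials_vanish[OF m \<open>n > 0\<close>] by blast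
      then show False
        using exists_odd_binomial_nonzero[OF two \<open>n > 0\<close>] by blast
    qed
    with 3 show ?thesis by simp
  qed
qed

theorem theorem3p1:
  fixes p n :: nat and k :: int
  assumes "CARD('p::prime_card) = p" and "odd p"
    and "0 \<le> k" and "k \<le> int p - 1"
    and "n > 1" and "even n"
  shows "self_reciprocal (f_poly n k :: 'p mod_ring poly) \<longleftrightarrow>
    k = 0 \<or> (k = 2 \<and> (\<forall>l::nat. l > 0 \<longrightarrow> n \<noteq> 2 * l * p))"
proof -
  have prime: "prime p"
    using prime_card[where 'a = 'p] assms(1) by simp
  with \<open>odd p\<close> have "p > 2"
    using prime_gt_1_nat[of p] by (cases "p = 2") auto
  have of_int_eq_0: "(of_int a :: 'p mod_ring) = 0 \<longleftrightarrow> int p dvd a" for a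
    using of_int_mod_ring_eq_0_iff[where 'a = 'p] assms(1) by simp
  have of_nat_eq_0: "(of_nat a :: 'p mod_ring) = 0 \<longleftrightarrow> p dvd a" for a
    using of_int_eq_0[of "int a"] by simp
  have two: "(2 :: 'p mod_ring) \<noteq> 0"
    using of_nat_eq_0[of 2] \<open>p > 2\<close> by (auto dest: dvd_imp_le)
  have k0: "(of_int k :: 'p mod_ring) = 0 \<longleftrightarrow> k = 0"
    unfolding of_int_eq_0 using assms(3,4) by (auto dest: zdvd_imp_le)
  have "(of_int k :: 'p mod_ring) = 2 \<longleftrightarrow> (of_int (k - 2) :: 'p mod_ring) = 0"
    by simp
  \<comment> \<open>Here k - 2 lies between -2 and p - 3, and p > 2, so 0 is the only multiple of
    \<open>p\<close> in range.\<close>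
  also have "\<dots> \<longleftrightarrow> k = 2"
    unfolding of_int_eq_0 using assms(3,4) \<open>p > 2\<close>
    using dvd_imp_le_int[of "k - 2" "int p"] by (cases "k = 2") auto
  finally have k2: "(of_int k :: 'p mod_ring) = 2 \<longleftrightarrow> k = 2" .
  have dvd_iff: "p dvd n \<longleftrightarrow> (\<exists>l>0. n = 2 * l * p)"
  proof
    assume "p dvd n"
    \<comment> \<open>2 and \<open>p\<close> are coprime, because \<open>p\<close> is odd.\<close>
    then have "2 * p dvd n"
      using \<open>even n\<close> \<open>odd p\<close> by (intro divides_mult) auto
    then obtain l where "n = 2 * p * l"
      by (elim dvdE)
    then show "\<exists>l>0. n = 2 * l * p"
      using \<open>n > 1\<close> by (intro exI[of _ l]) (auto intro: gr0I)
  qed auto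
  have "self_reciprocal (f_poly n k :: 'p mod_ring poly) \<longleftrightarrow> k = 0 \<or> k = 2 \<and> \<not> p dvd n"
    using self_reciprocal_f_poly_iff[OF two, of n k] assms(5,6) by (simp add: k0 k2 of_nat_eq_0)
  then show ?thesis
    unfolding dvd_iff by blast
qed

end
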